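(* Let $\vartheta>1$, let $s_{k-1}=z_k-z_{k-1}\in\mathbb{R}^{n+1}$ and $b_k\in\mathbb{R}^{n+1}$ be nonzero, and let $\Gamma_0$, $\varpi_k$ and $M(\mu)$ be as defined in the context. Let $R_k=\Gamma_0-1-\varpi_k^2$; then $R_k\ge0$. The largest $\mu\ge0$ satisfying $$M(\mu)^TM(\mu)\preceq\Gamma_0 I$$ is $$\mu_k^\star=\frac{\Gamma_0-1-\varpi_k^2}{\sqrt{\Gamma_0}+1}.$$ Moreover, $0\le\mu_k^\star\le\sqrt{\Gamma_0}-1$, and this upper bound is independent of $\tau$.
   Context: Let $f_1,\dots,f_m\in C^1(\mathbb{R}^n)$ have gradients that are Lipschitz on $\mathbb{R}^n$ with constants $L_i\ge0$; $\bar L=\sum_i L_i$; $\tau>0$, $\delta>0$. At $z_k=(x_k,t_k)\in\mathbb{R}^{n+1}$ let $\omega_{i,k}=\sqrt{(f_i(x_k)-t_k)^2+\tau^2}$, $J_k$ the $m\times(n+1)$ matrix with rows $(\nabla f_i(x_k)^T,-1)$, $D_k=\operatorname{diag}(\omega_{1,k}^{-1},\dots,\omega_{m,k}^{-1})$, $\Pi_x=\operatorname{diag}(I_n,0)$, and $P=P_k=\delta I_{n+1}+\bar L\Pi_x+\frac12J_k^TD_kJ_k$, a symmetric positive definite matrix. Write $s=s_{k-1}$, $b=b_k$, $C=s^TPs$, $B=b^TP^{-1}b$, $\chi_k=\chi=\frac{s^Tb}{\sqrt{CB}}\in[-1,1]$. Put $\Gamma_0=\frac{\vartheta^2}{\vartheta^2-1}$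 and $\varpi_k^2=\frac{1-\chi^2}{(\vartheta+\chi)^2}$. Let $u=P^{1/2}s/\sqrt C$ and $v=P^{-1/2}b/\sqrt B$, so that $\|u\|=\|v\|=1$ and $u^Tv=\chi$. For $\mu\ge0$ define the $(n+1)\times(n+1)$ matrix $$M(\mu)=I+\mu uu^T-\frac{uv^T-vu^T}{\vartheta+\chi}.$$ $\preceq$ is the Loewner order. *)

theory Defs
  imports "HOL-Analysis.Analysis"
begin

text \<open>A point \<open>z = (x, t)\<close> of the space of dimension \<open>n + 1\<close> is a vector indexed by
  \<^typ>\<open>'n option\<close>: the coordinates \<open>Some i\<close> form \<open>x\<close>, the coordinate \<open>None\<close> is \<open>t\<close>.\<close>

definition x_part :: "real^('n::finite option) \<Rightarrow> real^'n"
  where "x_part z = (\<chi> i. z $ Some i)"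

definition t_part :: "real^('n::finite option) \<Rightarrow> real"
  where "t_part z = z $ None"

definition grad :: "('a::real_inner \<Rightarrow> real) \<Rightarrow> 'a \<Rightarrow> 'a"
  where "grad f x = (THE g. GDERIV f x :> g)"

definition C1_lipschitz_grad :: "real \<Rightarrow> (real^'n \<Rightarrow> real) \<Rightarrow> bool"
  where "C1_lipschitz_grad L f \<longleftrightarrow>
    (\<forall>x. f differentiable (at x)) \<and> continuous_on UNIV (grad f) \<and> L-lipschitz_on UNIV (grad f)"

definition diag_matrix :: "('a \<Rightarrow> real) \<Rightarrow> real^'a^'a"
  where "diag_matrix d = (\<chi> i j. if i = j then d i else 0)"

definition outer :: "real^'a \<Rightarrow> real^'b \<Rightarrow> real^'b^'a"
  where "outer u v = (\<chi> i j. u $ i * v $ j)"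

definition psd :: "real^'a^'a \<Rightarrow> bool"
  where "psd A \<longleftrightarrow> transpose A = A \<and> (\<forall>x. 0 \<le> x \<bullet> (A *v x))"

definition loewner_le :: "real^'a^'a \<Rightarrow> real^'a^'a \<Rightarrow> bool"  (infix "\<preceq>\<^sub>L" 50)
  where "A \<preceq>\<^sub>L B \<longleftrightarrow> psd (B - A)"

text \<open>The principal square root: every symmetric positive semidefinite matrix has exactly one
  symmetric positive semidefinite square root. It is only used for positive definite matrices.\<close>

definition matrix_sqrt :: "real^'a^'a \<Rightarrow> real^'a^'a"
  where "matrix_sqrt A = (THE Q. psd Q \<and> Q ** Q = A)"

definition omega :: "('m \<Rightarrow> real^'n \<Rightarrow> real) \<Rightarrow> real \<Rightarrow> real^('n::finite option) \<Rightarrow> 'm \<Rightarrow> real"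
  where "omega f \<tau> z i = sqrt ((f i (x_part z) - t_part z)\<^sup>2 + \<tau>\<^sup>2)"

definition J_matrix :: "('m \<Rightarrow> real^'n \<Rightarrow> real) \<Rightarrow> real^('n::finite option) \<Rightarrow> real^('n::finite option)^'m"
  where "J_matrix f z =
    (\<chi> i j. case j of Some l \<Rightarrow> grad (f i) (x_part z) $ l | None \<Rightarrow> -1)"

definition D_matrix :: "('m \<Rightarrow> real^'n \<Rightarrow> real) \<Rightarrow> real \<Rightarrow> real^('n::finite option) \<Rightarrow> real^'m^'m"
  where "D_matrix f \<tau> z = diag_matrix (\<lambda>i. inverse (omega f \<tau> z i))"

definition Pi_x :: "real^('n::finite option)^('n option)"
  where "Pi_x = diag_matrix (\<lambda>j. case j of Some _ \<Rightarrow> 1 | None \<Rightarrow> 0)"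

definition P_matrix ::
  "('m::finite \<Rightarrow> real^'n \<Rightarrow> real) \<Rightarrow> ('m \<Rightarrow> real) \<Rightarrow> real \<Rightarrow> real \<Rightarrow> real^('n::finite option)
    \<Rightarrow> real^('n::finite option)^('n option)"
  where "P_matrix f L \<delta> \<tau> z =
    \<delta> *\<^sub>R mat 1 + (\<Sum>i\<in>UNIV. L i) *\<^sub>R Pi_x
      + (1/2) *\<^sub>R (transpose (J_matrix f z) ** D_matrix f \<tau> z ** J_matrix f z)"

definition C_val :: "real^'a^'a \<Rightarrow> real^'a \<Rightarrow> real"
  where "C_val P s = s \<bullet> (P *v s)"

definition B_val :: "real^'a^'a \<Rightarrow> real^'a \<Rightarrow> real"
  where "B_val P b = b \<bullet> (matrix_inv P *v b)"

definition chi_val :: "real^'a^'a \<Rightarrow> real^'a \<Rightarrow> real^'a \<Rightarrow> real"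
  where "chi_val P s b = (s \<bullet> b) / sqrt (C_val P s * B_val P b)"

definition u_vec :: "real^'a^'a \<Rightarrow> real^'a \<Rightarrow> real^'a"
  where "u_vec P s = (1 / sqrt (C_val P s)) *\<^sub>R (matrix_sqrt P *v s)"

definition v_vec :: "real^'a^'a \<Rightarrow> real^'a \<Rightarrow> real^'a"
  where "v_vec P b = (1 / sqrt (B_val P b)) *\<^sub>R (matrix_inv (matrix_sqrt P) *v b)"

definition Gamma0 :: "real \<Rightarrow> real"
  where "Gamma0 \<theta> = \<theta>\<^sup>2 / (\<theta>\<^sup>2 - 1)"

text \<open>The square \<open>\<varpi>\<^sup>2\<close>, as a function of \<open>\<theta>\<close> and \<open>\<chi>\<close>.\<close>

definition varpi_sq :: "real \<Rightarrow> real \<Rightarrow> real"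
  where "varpi_sq \<theta> c = (1 - c\<^sup>2) / (\<theta> + c)\<^sup>2"

definition R_val :: "real \<Rightarrow> real^'a^'a \<Rightarrow> real^'a \<Rightarrow> real^'a \<Rightarrow> real"
  where "R_val \<theta> P s b = Gamma0 \<theta> - 1 - varpi_sq \<theta> (chi_val P s b)"

definition mu_star :: "real \<Rightarrow> real^'a^'a \<Rightarrow> real^'a \<Rightarrow> real^'a \<Rightarrow> real"
  where "mu_star \<theta> P s b =
    (Gamma0 \<theta> - 1 - varpi_sq \<theta> (chi_val P s b)) / (sqrt (Gamma0 \<theta>) + 1)"

definition M_matrix ::
  "real \<Rightarrow> real^'a^'a \<Rightarrow> real^'a \<Rightarrow> real^'a \<Rightarrow> real \<Rightarrow> real^'a^'a"
  where "M_matrix \<theta> P s b \<mu> =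
    (let u = u_vec P s; v = v_vec P b in
      mat 1 + \<mu> *\<^sub>R outer u u
        - (1 / (\<theta> + chi_val P s b)) *\<^sub>R (outer u v - outer v u))"

end

theory Submission
  imports Defs
begin

text \<open>
  \<^emph>\<open>Reduction to a plane.\<close> The matrix \<open>M(\<mu>)\<close> is the identity on the orthogonal complement of the
  unit vectors \<open>u\<close> and \<open>v\<close>. With \<open>c = u \<bullet> v\<close>, \<open>a = 1 / (\<theta> + c)\<close>, \<open>p = u \<bullet> x\<close> and
  \<open>r = (v - c u) \<bullet> x\<close>, expanding the square gives
  \<open>\<parallel>M(\<mu>) x\<parallel>\<^sup>2 = \<parallel>x\<parallel>\<^sup>2 + (\<mu>\<^sup>2 + 2 \<mu> + \<varpi>\<^sup>2) p\<^sup>2 + a\<^sup>2 r\<^sup>2 - 2 \<mu> a p r\<close>. The vector \<open>v - c u\<close> is orthogonal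
  to \<open>u\<close> and has squared length \<open>1 - c\<^sup>2\<close>, so Cauchy-Schwarz bounds \<open>a\<^sup>2 r\<^sup>2\<close> by
  \<open>\<varpi>\<^sup>2 (\<parallel>x\<parallel>\<^sup>2 - p\<^sup>2)\<close>, with equality in the plane of \<open>u\<close> and \<open>v\<close>. Hence \<open>M(\<mu>)\<^sup>T M(\<mu>) \<preceq> \<Gamma> I\<close> is
  governed by the form \<open>(R - \<mu>\<^sup>2 - 2 \<mu>) p\<^sup>2 + R n\<^sup>2 + 2 \<mu> \<varpi> p n\<close>, where
  \<open>R = \<Gamma> - 1 - \<varpi>\<^sup>2\<close> and \<open>n\<close> is the coordinate orthogonal to \<open>u\<close>. Its determinant is
  \<open>(R - \<mu>)\<^sup>2 - \<Gamma> \<mu>\<^sup>2\<close>, so for \<open>\<mu> \<ge> 0\<close> the form is nonnegative exactly when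
  \<open>R - \<mu> \<ge> \<mu> \<surd>\<Gamma>\<close>, that is, when \<open>\<mu> \<le> R / (\<surd>\<Gamma> + 1)\<close>: sufficiency is
  \<open>psd_rank_two_update\<close>, necessity is \<open>rank_two_update_bound\<close>, which tests the form at its
  critical direction.

  \<^emph>\<open>Sign of \<open>R\<close>.\<close> The identity
  \<open>(\<theta> + c)\<^sup>2 - (\<theta>\<^sup>2 - 1) (1 - c\<^sup>2) = (1 + \<theta> c)\<^sup>2\<close> shows that
  \<open>\<varpi>\<^sup>2 \<le> 1 / (\<theta>\<^sup>2 - 1) = \<Gamma> - 1\<close>. The upper bound \<open>\<surd>\<Gamma> - 1\<close> comes from \<open>\<varpi>\<^sup>2 \<ge> 0\<close>, which
  holds because \<open>\<bar>c\<bar> \<le> 1\<close> for every positive definite \<open>P\<close>; this is its independence of \<open>\<tau>\<close>.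

  \<^emph>\<open>Normalisation.\<close> That \<open>u\<close> and \<open>v\<close> are unit vectors with \<open>u \<bullet> v = \<chi>\<close> is immediate from
  \<open>P = Q\<^sup>2\<close> with \<open>Q\<close> symmetric and invertible, once the principal square root \<open>Q\<close> is known to exist
  and to be unique. Both follow from an orthonormal basis of eigenvectors of \<open>P\<close>
  (\<open>orthonormal_eigenbasis\<close>), which is obtained by maximising the quadratic form of \<open>P\<close> on the unit
  sphere of the orthogonal complement of a largest orthonormal set of eigenvectors.
\<close>

section \<open>Eigenbases of self-adjoint maps\<close>

lemma linear_term_zero_if_nonneg:
  fixes c d :: real
  assumes "\<And>t. 0 \<le> 2 * t * c + t\<^sup>2 * d" and "0 \<le> d"
  shows "c = 0"
proof -
  define w where "w = c / (1 + d)"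
  have c: "c = w * (1 + d)" using assms(2) by (simp add: w_def)
  have "0 \<le> 2 * (- w) * c + (- w)\<^sup>2 * d" by (rule assms(1))
  also have "\<dots> = - (w\<^sup>2 * (2 + d))" unfolding c by (simp add: power2_eq_square algebra_simps)
  finally have "w\<^sup>2 * (2 + d) \<le> 0" by simp
  then have "w = 0" using assms(2) by (simp add: mult_le_0_iff)
  then show ?thesis using c by simp
qed

text \<open>A maximiser \<open>x\<close> of the quadratic form on the unit sphere is an eigenvector: the form
  \<open>l \<parallel>z\<parallel>\<^sup>2 - z \<bullet> f z\<close> is nonnegative on \<open>W\<close> and vanishes at \<open>x\<close>, so its first-order
  term at \<open>x\<close> vanishes, in particular in the direction \<open>l x - f x\<close>.\<close>

lemma eigenvector_in_invariant_subspace: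
  fixes f :: "'a::euclidean_space \<Rightarrow> 'a"
  assumes lin: "linear f" and sym: "\<And>x y. f x \<bullet> y = x \<bullet> f y"
    and W: "subspace W" "\<And>x. x \<in> W \<Longrightarrow> f x \<in> W"
    and x0: "x\<^sub>0 \<in> W" "x\<^sub>0 \<noteq> 0"
  obtains x l where "x \<in> W" "norm x = 1" "f x = l *\<^sub>R x"
proof -
  let ?S = "sphere 0 1 \<inter> W"
  have "compact ?S" by (simp add: W(1) closed_subspace compact_Int_closed)
  moreover have "(1 / norm x\<^sub>0) *\<^sub>R x\<^sub>0 \<in> ?S"
    using x0 W(1) by (simp add: subspace_scale)
  then have "?S \<noteq> {}" by blast
  moreover have "continuous_on ?S (\<lambda>x. x \<bullet> f x)"
    by (intro continuous_intros linear_continuous_on linear_conv_bounded_linear[THEN iffD1] lin)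
  ultimately obtain x where x: "x \<in> ?S" and max: "\<And>y. y \<in> ?S \<Longrightarrow> y \<bullet> f y \<le> x \<bullet> f x"
    using continuous_attains_sup[of ?S "\<lambda>x. x \<bullet> f x"] by blast
  define l where "l = x \<bullet> f x"
  define G where "G z = l * (z \<bullet> z) - z \<bullet> f z" for z
  have xW: "x \<in> W" and nx: "norm x = 1" using x by auto
  have xx: "x \<bullet> x = 1" using nx by (simp add: norm_eq_1)
  have G_nonneg: "0 \<le> G z" if z: "z \<in> W" for z
  proof (cases "z = 0")
    case False
    have "(1 / norm z) *\<^sub>R z \<in> ?S" using False z W(1) by (simp add: subspace_scale)
    from max[OF this] have "(z \<bullet> f z) / (norm z)\<^sup>2 \<le> l"
      by (simp add: linear_scale[OF lin] l_def power2_eq_square divide_inverse mult_ac)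
    then have "z \<bullet> f z \<le> l * (norm z)\<^sup>2" using False by (simp add: divide_le_eq)
    then show ?thesis by (simp add: G_def power2_norm_eq_inner)
  qed (simp add: G_def)
  define y where "y = l *\<^sub>R x - f x"
  have yW: "y \<in> W" unfolding y_def using xW W by (simp add: subspace_diff subspace_scale)
  have expand: "G (x + t *\<^sub>R y) = 2 * t * (y \<bullet> y) + t\<^sup>2 * G y" for t
  proof -
    have "G (x + t *\<^sub>R y) = G x + 2 * t * (l * (x \<bullet> y) - f x \<bullet> y) + t\<^sup>2 * G y"
      by (simp add: G_def linear_add[OF lin] linear_scale[OF lin] inner_add inner_commute[of y x]
          sym power2_eq_square algebra_simps) (metis inner_commute sym)
    moreover have "G x = 0" by (simp add: G_def xx l_def)
    moreover have "l * (x \<bullet> y) - f x \<bullet> y = y \<bullet> y" by (simp add: y_def inner_diff_left)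
    ultimately show ?thesis by simp
  qed
  have "y \<bullet> y = 0"
  proof (rule linear_term_zero_if_nonneg)
    show "0 \<le> 2 * t * (y \<bullet> y) + t\<^sup>2 * G y" for t
      unfolding expand[symmetric] using xW yW W(1)
      by (intro G_nonneg) (simp add: subspace_add subspace_scale)
  qed (rule G_nonneg[OF yW])
  then have "f x = l *\<^sub>R x" by (simp add: y_def)
  then show thesis using that xW nx by blast
qed

text \<open>An orthonormal set of eigenvectors of largest cardinality spans the space: its orthogonal
  complement is invariant, so otherwise it would contain a further eigenvector.\<close>

theorem orthonormal_eigenbasis:
  fixes f :: "'a::euclidean_space \<Rightarrow> 'a"
  assumes lin: "linear f" and sym: "\<And>x y. f x \<bullet> y = x \<bullet> f y"
  obtains E ev where "finite E" "pairwise orthogonal E" "\<And>e. e \<in> E \<Longrightarrow> norm e = 1"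
    "span E = UNIV" "\<And>e. e \<in> E \<Longrightarrow> f e = ev e *\<^sub>R e"
proof -
  define ok where "ok E \<longleftrightarrow> pairwise orthogonal E \<and> (\<forall>e\<in>E. norm e = 1) \<and>
    (\<forall>e\<in>E. \<exists>l. f e = l *\<^sub>R e)" for E
  have bound: "finite E \<and> card E \<le> DIM('a)" if "ok E" for E
  proof -
    have "independent E"
      using that by (intro pairwise_orthogonal_independent) (auto simp: ok_def)
    then show ?thesis using independent_bound by blast
  qed
  have "ok {}" by (simp add: ok_def)
  then obtain E where E: "ok E" and max: "\<And>F. ok F \<Longrightarrow> card F \<le> card E"
    using ex_has_greatest_nat[of ok "{}" card "Suc (DIM('a))"] bound by (metis less_Suc_eq_le)
  have finE: "finite E" using bound E by blast
  have spanE: "span E = UNIV"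
  proof (rule ccontr)
    assume "span E \<noteq> UNIV"
    then have "dim E < DIM('a)"
      by (metis dim_eq_full dim_subset_UNIV le_neq_implies_less)
    then obtain x0 where x0: "x0 \<noteq> 0" "\<And>y. y \<in> span E \<Longrightarrow> orthogonal x0 y"
      using orthogonal_to_subspace_exists by blast
    define W where "W = {x. \<forall>e\<in>E. e \<bullet> x = 0}"
    have "subspace W" by (auto simp: W_def subspace_def inner_add_right)
    moreover have "f x \<in> W" if x: "x \<in> W" for x
    proof -
      have "e \<bullet> f x = 0" if e: "e \<in> E" for e
      proof -
        obtain l where "f e = l *\<^sub>R e" using e E by (auto simp: ok_def)
        then show ?thesis using x e sym[of e x] by (simp add: W_def)
      qed
      then show ?thesis by (simp add: W_def)
    qed
    moreover have "x0 \<in> W"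
      using x0(2) by (auto simp: W_def orthogonal_def inner_commute span_base)
    ultimately obtain x l where x: "x \<in> W" "norm x = 1" "f x = l *\<^sub>R x"
      using eigenvector_in_invariant_subspace[OF lin sym] x0(1) by metis
    have "x \<notin> E"
      using x(1,2) by (auto simp: W_def)
    moreover have "ok (insert x E)"
      using E x by (auto simp: ok_def pairwise_insert W_def orthogonal_def inner_commute)
    ultimately show False using max[of "insert x E"] finE by simp
  qed
  have "\<forall>e\<in>E. \<exists>l. f e = l *\<^sub>R e" using E by (simp add: ok_def)
  then obtain ev where "\<And>e. e \<in> E \<Longrightarrow> f e = ev e *\<^sub>R e" by metis
  moreover have "pairwise orthogonal E" "\<And>e. e \<in> E \<Longrightarrow> norm e = 1"
    using E by (auto simp: ok_def)
  ultimately show thesis using that finE spanE by blast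
qed

section \<open>The principal square root of a positive semidefinite matrix\<close>

lemma symmetric_dot_commute:
  fixes A :: "real^'a^'a"
  assumes "transpose A = A"
  shows "(A *v x) \<bullet> y = x \<bullet> (A *v y)"
  using dot_lmul_matrix[of x A y] transpose_matrix_vector[of A x] assms by simp

lemma symmetric_if_dot_commute:
  fixes A :: "real^'a^'a"
  assumes "\<And>x y. (A *v x) \<bullet> y = x \<bullet> (A *v y)"
  shows "transpose A = A"
proof -
  have "transpose A *v x = A *v x" for x
  proof -
    have "(transpose A *v x) \<bullet> y = (A *v x) \<bullet> y" for y
      using dot_lmul_matrix[of x A y] assms[of x y] by simp
    then show ?thesis using vector_eq_rdot by blast
  qed
  then show ?thesis by (simp add: matrix_eq del: transpose_matrix_vector)
qed

text \<open>If \<open>Q\<^sup>2 x = l x\<close> then \<open>y = Q x - \<surd>l x\<close> satisfies \<open>Q y = - \<surd>l y\<close>, which positivity of \<open>Q\<close>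
  forbids unless \<open>y = 0\<close> or \<open>l = 0\<close>. Thus a positive semidefinite square root is determined on every
  eigenvector.\<close>

lemma psd_sqrt_eigenvector:
  fixes Q :: "real^'a^'a"
  assumes Q: "psd Q" and eig: "(Q ** Q) *v x = l *\<^sub>R x" and l: "0 \<le> l"
  shows "Q *v x = sqrt l *\<^sub>R x"
proof (cases "l = 0")
  case True
  have "(Q *v x) \<bullet> (Q *v x) = x \<bullet> ((Q ** Q) *v x)"
    using symmetric_dot_commute[of Q x "Q *v x"] Q by (simp add: psd_def matrix_vector_mul_assoc)
  then show ?thesis using True eig by simp
next
  case False
  define y where "y = Q *v x - sqrt l *\<^sub>R x"
  have "Q *v y = l *\<^sub>R x - sqrt l *\<^sub>R (Q *v x)"
    using eig by (simp add: y_def matrix_vector_mult_diff_distrib matrix_vector_mult_scaleR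
        matrix_vector_mul_assoc)
  also have "\<dots> = - (sqrt l *\<^sub>R y)"
    using l by (simp add: y_def scaleR_right_diff_distrib)
  finally have "y \<bullet> (Q *v y) = - (sqrt l * (y \<bullet> y))" by simp
  moreover have "0 \<le> y \<bullet> (Q *v y)" using Q by (simp add: psd_def)
  ultimately have "sqrt l * (y \<bullet> y) \<le> 0" by simp
  moreover have "0 < sqrt l" using l False by simp
  ultimately have "y \<bullet> y \<le> 0" by (simp add: mult_le_0_iff)
  then have "y = 0" using inner_ge_zero[of y] by (metis antisym inner_eq_zero_iff)
  then show ?thesis by (simp add: y_def)
qed

text \<open>In an orthonormal eigenbasis the square root replaces each eigenvalue by its root.\<close>

theorem ex1_psd_sqrt:
  fixes A :: "real^'a^'a"
  assumes A: "psd A"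
  shows "\<exists>!Q. psd Q \<and> Q ** Q = A"
proof -
  have symA: "(A *v x) \<bullet> y = x \<bullet> (A *v y)" for x y
    using A symmetric_dot_commute by (auto simp: psd_def)
  obtain E ev where E: "finite E" "pairwise orthogonal E" "\<And>e. e \<in> E \<Longrightarrow> norm e = 1"
    "span E = UNIV" and eig: "\<And>e. e \<in> E \<Longrightarrow> A *v e = ev e *\<^sub>R e"
    using orthonormal_eigenbasis[of "(*v) A"] symA by blast
  have nonneg: "0 \<le> ev e" if "e \<in> E" for e
  proof -
    have "e \<bullet> (A *v e) = ev e" using eig[OF that] E(3)[OF that] by (simp add: norm_eq_1)
    then show ?thesis using A by (metis psd_def)
  qed
  have determined: "S = T" if "\<And>e. e \<in> E \<Longrightarrow> S *v e = T *v e" for S T :: "real^'a^'a"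
    using linear_eq_on_span[of "(*v) S" "(*v) T" E] that E(4) by (simp add: matrix_eq)
  define q where "q x = (\<Sum>e\<in>E. (sqrt (ev e) * (x \<bullet> e)) *\<^sub>R e)" for x
  have "linear q"
    unfolding q_def
    by (rule linearI) (simp_all add: inner_add_left algebra_simps sum.distrib scaleR_sum_right)
  then have Q: "matrix q *v x = q x" for x
    by (simp add: matrix_works)
  have q_eig: "q e = sqrt (ev e) *\<^sub>R e" if e: "e \<in> E" for e
  proof -
    have "q e = (\<Sum>d\<in>E. if d = e then sqrt (ev e) *\<^sub>R e else 0)"
      unfolding q_def using E(2,3) e
      by (intro sum.cong) (auto simp: pairwise_def orthogonal_def norm_eq_1)
    then show ?thesis using E(1) e by simp
  qed
  have "transpose (matrix q) = matrix q"
    by (rule symmetric_if_dot_commute)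
      (simp add: Q q_def inner_sum_left inner_sum_right inner_commute mult_ac)
  moreover have "0 \<le> x \<bullet> q x" for x
  proof -
    have "x \<bullet> q x = (\<Sum>e\<in>E. sqrt (ev e) * (x \<bullet> e)\<^sup>2)"
      by (simp add: q_def inner_sum_right power2_eq_square mult.assoc)
    then show ?thesis using nonneg by (simp add: sum_nonneg)
  qed
  ultimately have psdQ: "psd (matrix q)" by (simp add: psd_def Q)
  have "matrix q ** matrix q = A"
  proof (rule determined)
    fix e assume e: "e \<in> E"
    show "(matrix q ** matrix q) *v e = A *v e"
      using q_eig[OF e] nonneg[OF e] eig[OF e] linear_scale[OF \<open>linear q\<close>]
      by (simp add: matrix_vector_mul_assoc[symmetric] Q)
  qed
  with psdQ show ?thesis
  proof (intro ex1I[of _ "matrix q"] conjI)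
    fix S assume S: "psd S \<and> S ** S = A"
    show "S = matrix q"
      by (rule determined) (use psd_sqrt_eigenvector[of S] S eig nonneg q_eig Q in auto)
  qed auto
qed

lemma
  fixes A :: "real^'a^'a"
  assumes "psd A"
  shows psd_matrix_sqrt: "psd (matrix_sqrt A)"
    and matrix_sqrt_square: "matrix_sqrt A ** matrix_sqrt A = A"
  using theI'[OF ex1_psd_sqrt[OF assms]] unfolding matrix_sqrt_def by auto

section \<open>Normalised vectors\<close>

definition pos_def :: "real^'a^'a \<Rightarrow> bool"
  where "pos_def A \<longleftrightarrow> transpose A = A \<and> (\<forall>x. x \<noteq> 0 \<longrightarrow> 0 < x \<bullet> (A *v x))"

lemma psd_if_pos_def: "pos_def A \<Longrightarrow> psd A"
  unfolding pos_def_def psd_def by (metis inner_zero_left order_less_le order_refl)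

lemma mult_matrix_inv_if_kernel_trivial:
  fixes A :: "real^'a^'a"
  assumes "\<And>x. A *v x = 0 \<Longrightarrow> x = 0"
  shows "A *v (matrix_inv A *v y) = y"
proof -
  have "\<exists>B. B ** A = mat 1" using assms by (simp add: matrix_left_invertible_ker)
  then have "invertible A" using invertible_left_inverse by blast
  then have "A ** matrix_inv A = mat 1"
    unfolding invertible_def matrix_inv_def by (rule someI2_ex) blast
  then show ?thesis by (simp add: matrix_vector_mul_assoc)
qed

lemma normalised_vectors:
  fixes P :: "real^'a^'a"
  assumes P: "pos_def P" and s: "s \<noteq> 0" and b: "b \<noteq> 0"
  shows "u_vec P s \<bullet> u_vec P s = 1" and "v_vec P b \<bullet> v_vec P b = 1"
    and "u_vec P s \<bullet> v_vec P b = chi_val P s b"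
proof -
  define Q where "Q = matrix_sqrt P"
  have QQ: "Q *v (Q *v x) = P *v x" for x
    using matrix_sqrt_square[OF psd_if_pos_def[OF P]] by (simp add: Q_def matrix_vector_mul_assoc)
  have sym: "(Q *v x) \<bullet> y = x \<bullet> (Q *v y)" for x y
    using psd_matrix_sqrt[OF psd_if_pos_def[OF P]]
    by (intro symmetric_dot_commute) (simp add: Q_def psd_def)
  have kerP: "x = 0" if "P *v x = 0" for x
    using P that by (metis inner_zero_right less_irrefl pos_def_def)
  have kerQ: "x = 0" if "Q *v x = 0" for x
    using QQ[of x] that by (simp add: kerP)
  define y where "y = matrix_inv Q *v b"
  define w where "w = matrix_inv P *v b"
  have Qy: "Q *v y = b" unfolding y_def using kerQ by (rule mult_matrix_inv_if_kernel_trivial)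
  have Pw: "P *v w = b" unfolding w_def using kerP by (rule mult_matrix_inv_if_kernel_trivial)
  \<comment> \<open>Since \<open>Q\<^sup>2 w = b = Q y\<close>, the vector \<open>y = Q w\<close> has squared length
    \<open>w \<bullet> Q\<^sup>2 w = w \<bullet> b\<close>, which is \<open>B\<close>.\<close>
  have "Q *v (Q *v w - y) = 0" using Qy Pw QQ by (simp add: matrix_vector_mult_diff_distrib)
  then have Qw: "Q *v w = y" using kerQ by fastforce
  have C: "C_val P s = (Q *v s) \<bullet> (Q *v s)" by (simp add: C_val_def sym QQ)
  have B: "B_val P b = y \<bullet> y"
    using sym[of y w] Qy Qw by (simp add: B_val_def w_def[symmetric])
  have C0: "0 < C_val P s" using P s by (simp add: C_val_def pos_def_def)
  have "y \<noteq> 0" using Qy b by auto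
  then have B0: "0 < B_val P b" by (simp add: B)
  have u: "u_vec P s = (1 / sqrt (C_val P s)) *\<^sub>R (Q *v s)" by (simp add: u_vec_def Q_def)
  have v: "v_vec P b = (1 / sqrt (B_val P b)) *\<^sub>R y" by (simp add: v_vec_def Q_def y_def)
  show "u_vec P s \<bullet> u_vec P s = 1" using C0 by (simp add: u C[symmetric])
  show "v_vec P b \<bullet> v_vec P b = 1" using B0 by (simp add: v B[symmetric])
  show "u_vec P s \<bullet> v_vec P b = chi_val P s b"
    by (simp add: u v chi_val_def sym Qy real_sqrt_mult)
qed

lemma abs_chi_le_1:
  assumes "pos_def P" and "s \<noteq> 0" and "b \<noteq> 0"
  shows "\<bar>chi_val P s b\<bar> \<le> 1"
  using Cauchy_Schwarz_ineq2[of "u_vec P s" "v_vec P b"] normalised_vectors[OF assms]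
  by (simp add: norm_eq_sqrt_inner)

section \<open>Positive definiteness of the metric\<close>

lemma transpose_add: "transpose (A + B) = transpose A + transpose B"
  by (simp add: transpose_def vec_eq_iff)

lemma transpose_diag_matrix: "transpose (diag_matrix d) = diag_matrix d"
  by (auto simp: transpose_def diag_matrix_def vec_eq_iff)

lemma diag_matrix_quadratic_form_nonneg:
  fixes x :: "real^'a"
  assumes "\<And>i. 0 \<le> d i"
  shows "0 \<le> x \<bullet> (diag_matrix d *v x)"
proof -
  have "(diag_matrix d *v x) $ i = d i * x $ i" for i
    by (simp add: matrix_vector_mult_def diag_matrix_def if_distrib[of "\<lambda>t. t * _"]
        cong: if_cong)
  then have "x \<bullet> (diag_matrix d *v x) = (\<Sum>i\<in>UNIV. d i * (x $ i)\<^sup>2)"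
    by (simp add: inner_vec_def power2_eq_square mult.left_commute)
  then show ?thesis using assms by (simp add: sum_nonneg)
qed

lemma pos_def_P_matrix:
  fixes f :: "'m::finite \<Rightarrow> real^'n::finite \<Rightarrow> real"
  assumes L: "\<And>i. 0 \<le> L i" and \<delta>: "0 < \<delta>"
  shows "pos_def (P_matrix f L \<delta> \<tau> z)"
proof -
  define J where "J = J_matrix f z"
  define D where "D = D_matrix f \<tau> z"
  have P: "P_matrix f L \<delta> \<tau> z = \<delta> *\<^sub>R mat 1 + (\<Sum>i\<in>UNIV. L i) *\<^sub>R Pi_x
      + (1/2) *\<^sub>R (transpose J ** D ** J)"
    by (simp add: P_matrix_def J_def D_def)
  have "transpose D = D" by (simp add: D_def D_matrix_def transpose_diag_matrix)
  then have "transpose (P_matrix f L \<delta> \<tau> z) = P_matrix f L \<delta> \<tau> z"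
    by (simp add: P transpose_add transpose_scalar matrix_transpose_mul matrix_mul_assoc
        Pi_x_def transpose_diag_matrix)
  moreover have "0 < x \<bullet> (P_matrix f L \<delta> \<tau> z *v x)" if x: "x \<noteq> 0" for x
  proof -
    have "x \<bullet> ((transpose J ** D ** J) *v x) = (J *v x) \<bullet> (D *v (J *v x))"
      using dot_lmul_matrix[of x "transpose J" "D *v (J *v x)"]
      by (simp add: matrix_vector_mul_assoc[symmetric] del: transpose_matrix_vector)
    also have "0 \<le> \<dots>"
      unfolding D_def D_matrix_def
      by (rule diag_matrix_quadratic_form_nonneg) (simp add: omega_def)
    finally have J: "0 \<le> x \<bullet> ((transpose J ** D ** J) *v x)" .
    have Pi: "0 \<le> x \<bullet> (Pi_x *v x)"
      unfolding Pi_x_def by (rule diag_matrix_quadratic_form_nonneg) (simp split: option.split)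
    have "x \<bullet> (P_matrix f L \<delta> \<tau> z *v x) = \<delta> * (x \<bullet> x) + (\<Sum>i\<in>UNIV. L i) * (x \<bullet> (Pi_x *v x))
        + (1/2) * (x \<bullet> ((transpose J ** D ** J) *v x))"
      unfolding P
      by (simp only: matrix_vector_mult_add_rdistrib scaleR_matrix_vector_assoc[symmetric]
          inner_add_right inner_scaleR_right matrix_vector_mul_lid)
    moreover have "0 < \<delta> * (x \<bullet> x)" using x \<delta> by simp
    moreover have "0 \<le> (\<Sum>i\<in>UNIV. L i) * (x \<bullet> (Pi_x *v x))"
      using L Pi by (simp add: sum_nonneg)
    ultimately show ?thesis using J by simp
  qed
  ultimately show ?thesis by (simp add: pos_def_def)
qed

section \<open>The rank-two update of the identity\<close>

definition rank_two_update :: "real \<Rightarrow> real \<Rightarrow> real^'a \<Rightarrow> real^'a \<Rightarrow> real^'a^'a"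
  where "rank_two_update a \<mu> u v = mat 1 + \<mu> *\<^sub>R outer u u - a *\<^sub>R (outer u v - outer v u)"

lemma outer_mult_vec: "outer u v *v x = (v \<bullet> x) *\<^sub>R u"
  by (simp add: outer_def matrix_vector_mult_def vec_eq_iff inner_vec_def sum_distrib_left
      sum_distrib_right mult_ac)

lemma rank_two_update_mult_vec:
  "rank_two_update a \<mu> u v *v x = x + (\<mu> * (u \<bullet> x) - a * (v \<bullet> x)) *\<^sub>R u + (a * (u \<bullet> x)) *\<^sub>R v"
  by (simp add: rank_two_update_def matrix_vector_mult_add_rdistrib
      matrix_vector_mult_diff_rdistrib scaleR_matrix_vector_assoc[symmetric] outer_mult_vec
      algebra_simps)

text \<open>Only the component of \<open>v\<close> orthogonal to \<open>u\<close> enters, because \<open>u v\<^sup>T - v u\<^sup>T\<close> does not change when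
  a multiple of \<open>u\<close> is subtracted from \<open>v\<close>.\<close>

lemma rank_two_update_norm_sq:
  fixes u v x :: "real^'a"
  assumes u: "u \<bullet> u = 1" and v: "v \<bullet> v = 1"
  defines "c \<equiv> u \<bullet> v" and "p \<equiv> u \<bullet> x"
  defines "r \<equiv> (v - c *\<^sub>R u) \<bullet> x"
  shows "(rank_two_update a \<mu> u v *v x) \<bullet> (rank_two_update a \<mu> u v *v x) =
    x \<bullet> x + (\<mu>\<^sup>2 + 2 * \<mu> + a\<^sup>2 * (1 - c\<^sup>2)) * p\<^sup>2 + a\<^sup>2 * r\<^sup>2 - 2 * \<mu> * a * p * r"
proof -
  have vx: "v \<bullet> x = r + c * p" by (simp add: r_def p_def inner_diff_left)
  show ?thesis
    by (simp add: rank_two_update_mult_vec inner_add_left inner_add_right u v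
        inner_commute[of x u] inner_commute[of x v] inner_commute[of v u]
        c_def[symmetric] p_def[symmetric] vx)
      (simp add: power2_eq_square algebra_simps)
qed

lemma gram_loewner_le_iff:
  fixes M :: "real^'a^'a"
  shows "transpose M ** M \<preceq>\<^sub>L g *\<^sub>R mat 1 \<longleftrightarrow> (\<forall>x. (M *v x) \<bullet> (M *v x) \<le> g * (x \<bullet> x))"
proof -
  have "transpose (g *\<^sub>R mat 1 - transpose M ** M) = g *\<^sub>R mat 1 - transpose M ** M"
    by (simp add: transpose_def matrix_matrix_mult_def mat_def vec_eq_iff mult.commute)
  moreover have "x \<bullet> ((g *\<^sub>R mat 1 - transpose M ** M) *v x) = g * (x \<bullet> x) - (M *v x) \<bullet> (M *v x)" for x
  proof -
    have "x \<bullet> ((transpose M ** M) *v x) = (M *v x) \<bullet> (M *v x)"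
      using dot_lmul_matrix[of x "transpose M" "M *v x"]
      by (simp add: matrix_vector_mul_assoc[symmetric] del: transpose_matrix_vector)
    then show ?thesis
      by (simp add: matrix_vector_mult_diff_rdistrib inner_diff_right
          scaleR_matrix_vector_assoc[symmetric])
  qed
  ultimately show ?thesis unfolding loewner_le_def psd_def by simp
qed

lemma component_orthogonal_to_unit:
  fixes u v :: "'a::real_inner"
  assumes "u \<bullet> u = 1" and "v \<bullet> v = 1"
  shows "u \<bullet> (v - (u \<bullet> v) *\<^sub>R u) = 0"
    and "(v - (u \<bullet> v) *\<^sub>R u) \<bullet> (v - (u \<bullet> v) *\<^sub>R u) = 1 - (u \<bullet> v)\<^sup>2"
  using assms by (simp_all add: inner_diff_left inner_diff_right inner_commute[of v u]
      power2_eq_square)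

text \<open>Here \<open>g = \<surd>\<Gamma>\<close>. Substituting \<open>R = (g + 1) \<mu>\<close> makes \<open>\<mu>\<close> a factor of the whole form once
  \<open>r\<^sup>2\<close> is replaced by its Cauchy-Schwarz bound, and the remaining cross term is bounded by the arithmetic-geometric mean inequality.\<close>

lemma psd_rank_two_update:
  fixes u v :: "real^'a"
  assumes u: "u \<bullet> u = 1" and v: "v \<bullet> v = 1"
    and \<mu>: "0 \<le> \<mu>" "\<mu> \<le> g - 1"
    and eq: "(g + 1) * \<mu> = g\<^sup>2 - 1 - a\<^sup>2 * (1 - (u \<bullet> v)\<^sup>2)"
  shows "transpose (rank_two_update a \<mu> u v) ** rank_two_update a \<mu> u v \<preceq>\<^sub>L g\<^sup>2 *\<^sub>R mat 1"
  unfolding gram_loewner_le_iff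
proof
  fix x
  define c p q where "c = u \<bullet> v" and "p = u \<bullet> x" and "q = v - c *\<^sub>R u"
  define r N h where "r = q \<bullet> x" and "N = x \<bullet> x - p\<^sup>2" and "h = g - 1 - \<mu>"
  have h: "0 \<le> h" and g: "1 \<le> g" using \<mu> by (simp_all add: h_def)
  note q = component_orthogonal_to_unit[OF u v, folded c_def, folded q_def]
  have N: "N = (x - p *\<^sub>R u) \<bullet> (x - p *\<^sub>R u)"
    using u by (simp add: N_def p_def inner_diff_left inner_diff_right inner_commute[of x u]
        power2_eq_square)
  have "q \<bullet> (x - p *\<^sub>R u) = r"
    using q(1) by (simp add: r_def inner_diff_right inner_commute[of q u])
  then have "r\<^sup>2 \<le> (1 - c\<^sup>2) * N"
    using Cauchy_Schwarz_ineq[of q "x - p *\<^sub>R u"] q(2) N by simp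
  then have "a\<^sup>2 * r\<^sup>2 \<le> a\<^sup>2 * ((1 - c\<^sup>2) * N)" by (intro mult_left_mono) auto
  also have var: "a\<^sup>2 * (1 - c\<^sup>2) = (g + 1) * h"
    using eq by (simp add: c_def h_def power2_eq_square algebra_simps)
  then have "a\<^sup>2 * ((1 - c\<^sup>2) * N) = ((g + 1) * N) * h" by (metis mult.assoc mult.commute)
  finally have ar: "(a * r)\<^sup>2 \<le> ((g + 1) * N) * h" by (simp add: power_mult_distrib)
  have N0: "0 \<le> (g + 1) * N" using g by (simp add: N)
  have cross: "0 \<le> h * p\<^sup>2 + (g + 1) * N + 2 * p * (a * r)"
  proof -
    have "(2 * p * (a * r))\<^sup>2 = 4 * p\<^sup>2 * (a * r)\<^sup>2" by (simp add: power_mult_distrib)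
    also have "\<dots> \<le> 4 * p\<^sup>2 * (((g + 1) * N) * h)" using ar by (intro mult_left_mono) auto
    also have "\<dots> \<le> (h * p\<^sup>2 + (g + 1) * N)\<^sup>2"
      using zero_le_power2[of "h * p\<^sup>2 - (g + 1) * N"]
      by (simp add: power2_eq_square algebra_simps)
    finally have "\<bar>2 * p * (a * r)\<bar> \<le> h * p\<^sup>2 + (g + 1) * N"
      using h N0 by (intro abs_le_square_iff[THEN iffD2, THEN order_trans[OF _ eq_refl]])
        (auto simp: abs_of_nonneg)
    then show ?thesis by linarith
  qed
  have "g\<^sup>2 * (x \<bullet> x) - (rank_two_update a \<mu> u v *v x) \<bullet> (rank_two_update a \<mu> u v *v x)
      = (g\<^sup>2 - 1) * (N + p\<^sup>2) - (\<mu>\<^sup>2 + 2 * \<mu> + (g + 1) * h) * p\<^sup>2 - (a * r)\<^sup>2 + 2 * \<mu> * a * p * r"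
    unfolding rank_two_update_norm_sq[OF u v] var[symmetric]
    by (simp add: c_def[symmetric] p_def[symmetric] q_def[symmetric] r_def[symmetric] N_def
        power_mult_distrib algebra_simps)
  also have "\<dots> \<ge> (g\<^sup>2 - 1) * (N + p\<^sup>2) - (\<mu>\<^sup>2 + 2 * \<mu> + (g + 1) * h) * p\<^sup>2 - (g + 1) * N * h
      + 2 * \<mu> * a * p * r"
    using ar by simp
  also have "(g\<^sup>2 - 1) * (N + p\<^sup>2) - (\<mu>\<^sup>2 + 2 * \<mu> + (g + 1) * h) * p\<^sup>2 - (g + 1) * N * h
      + 2 * \<mu> * a * p * r = \<mu> * (h * p\<^sup>2 + (g + 1) * N + 2 * p * (a * r))"
    by (simp add: h_def power2_eq_square algebra_simps)
  finally show "(rank_two_update a \<mu> u v *v x) \<bullet> (rank_two_update a \<mu> u v *v x) \<le> g\<^sup>2 * (x \<bullet> x)"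
    using mult_nonneg_nonneg[OF \<mu>(1) cross] by linarith
qed

text \<open>Necessity has to be tested in the plane of \<open>u\<close> and \<open>v\<close>: testing with \<open>u\<close> alone gives only
  \<open>\<mu>\<^sup>2 + 2 \<mu> \<le> R\<close>, which is weaker in general, but it fixes the sign of \<open>R - \<mu>\<close> when the
  determinant condition is reduced to a linear one.\<close>

lemma rank_two_update_bound:
  fixes u v :: "real^'a"
  assumes u: "u \<bullet> u = 1" and v: "v \<bullet> v = 1"
    and g: "0 \<le> g" and \<mu>: "0 \<le> \<mu>"
    and R: "R = g\<^sup>2 - 1 - a\<^sup>2 * (1 - (u \<bullet> v)\<^sup>2)" "0 \<le> R"
    and le: "transpose (rank_two_update a \<mu> u v) ** rank_two_update a \<mu> u v \<preceq>\<^sub>L g\<^sup>2 *\<^sub>R mat 1"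
  shows "(g + 1) * \<mu> \<le> R"
proof -
  define c q where "c = u \<bullet> v" and "q = v - c *\<^sub>R u"
  note q = component_orthogonal_to_unit[OF u v, folded c_def, folded q_def]
  define w where "w = a\<^sup>2 * (1 - c\<^sup>2)"
  \<comment> \<open>On the plane of \<open>u\<close> and \<open>v\<close> the Cauchy-Schwarz bound on \<open>r\<close> is an equality.\<close>
  have form: "0 \<le> (R - \<mu>\<^sup>2 - 2 * \<mu>) * \<alpha>\<^sup>2 + R * (\<beta>\<^sup>2 * (1 - c\<^sup>2)) + 2 * \<mu> * a * \<alpha> * \<beta> * (1 - c\<^sup>2)"
    for \<alpha> \<beta>
  proof -
    define x where "x = \<alpha> *\<^sub>R u + \<beta> *\<^sub>R q"
    have p: "u \<bullet> x = \<alpha>" using u q by (simp add: x_def inner_add_right)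
    have r: "q \<bullet> x = \<beta> * (1 - c\<^sup>2)"
      using q by (simp add: x_def inner_add_right inner_commute[of q u])
    have xx: "x \<bullet> x = \<alpha>\<^sup>2 + \<beta>\<^sup>2 * (1 - c\<^sup>2)"
      using u q by (simp add: x_def inner_add_right inner_add_left inner_commute[of q u]
          power2_eq_square)
    have "(rank_two_update a \<mu> u v *v x) \<bullet> (rank_two_update a \<mu> u v *v x) \<le> g\<^sup>2 * (x \<bullet> x)"
      using le by (simp add: gram_loewner_le_iff)
    then show ?thesis
      unfolding rank_two_update_norm_sq[OF u v] c_def[symmetric] q_def[symmetric] p r xx R(1)
      by (simp add: power2_eq_square algebra_simps)
  qed
  have diag: "\<mu>\<^sup>2 + 2 * \<mu> \<le> R" using form[of 1 0] by simp
  show ?thesis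
  proof (cases "R = 0")
    case True
    then have "\<mu> = 0" using diag \<mu> by (smt (verit) zero_le_power2)
    then show ?thesis using True by simp
  next
    case False
    \<comment> \<open>The direction \<open>(R, - \<mu> a)\<close> minimises the form for given \<open>\<alpha>\<close>; its value there is \<open>R\<close> times the
      determinant.\<close>
    have "0 \<le> R * ((R - \<mu>)\<^sup>2 - (g * \<mu>)\<^sup>2)"
    proof -
      have g2: "g\<^sup>2 = R + 1 + w" using R(1) by (simp add: w_def c_def)
      have "0 \<le> R * (R * (R - \<mu>\<^sup>2 - 2 * \<mu>) - \<mu>\<^sup>2 * w)"
        using form[of R "- (\<mu> * a)"] by (simp add: w_def power2_eq_square algebra_simps)
      also have "R * (R - \<mu>\<^sup>2 - 2 * \<mu>) - \<mu>\<^sup>2 * w = (R - \<mu>)\<^sup>2 - (g * \<mu>)\<^sup>2"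
        by (simp add: power_mult_distrib g2) (simp add: power2_eq_square algebra_simps)
      finally show ?thesis .
    qed
    then have "(g * \<mu>)\<^sup>2 \<le> (R - \<mu>)\<^sup>2" using False R(2) by (simp add: zero_le_mult_iff)
    moreover have "0 \<le> R - \<mu>" using diag \<mu> by (smt (verit) zero_le_power2)
    ultimately have "g * \<mu> \<le> R - \<mu>" by (rule power2_le_imp_le)
    then show ?thesis by (simp add: algebra_simps)
  qed
qed

section \<open>The largest admissible scaling\<close>

lemma Gamma0_minus_1: "1 < \<theta> \<Longrightarrow> Gamma0 \<theta> - 1 = 1 / (\<theta>\<^sup>2 - 1)"
  by (auto simp: Gamma0_def divide_simps power2_eq_1_iff)

lemma Gamma0_gt_1: "1 < \<theta> \<Longrightarrow> 1 < Gamma0 \<theta>"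
  using Gamma0_minus_1[of \<theta>] one_less_power[of \<theta> 2] by (smt (verit) divide_pos_pos zero_less_numeral)

lemma varpi_sq_nonneg: "\<bar>c\<bar> \<le> 1 \<Longrightarrow> 0 \<le> varpi_sq \<theta> c"
  by (simp add: varpi_sq_def abs_square_le_1)

text \<open>The gap \<open>(\<theta> + c)\<^sup>2 - (\<theta>\<^sup>2 - 1) (1 - c\<^sup>2)\<close> is the square \<open>(1 + \<theta> c)\<^sup>2\<close>, so \<open>\<Gamma>\<close> is the
  smallest level that works for every angle: equality holds at \<open>c = - 1 / \<theta>\<close>.\<close>

lemma varpi_sq_le:
  assumes "1 < \<theta>" and "\<bar>c\<bar> \<le> 1"
  shows "varpi_sq \<theta> c \<le> Gamma0 \<theta> - 1"
proof -
  have "0 \<le> (1 + \<theta> * c)\<^sup>2" by simp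
  then have "(1 - c\<^sup>2) * (\<theta>\<^sup>2 - 1) \<le> (\<theta> + c)\<^sup>2" by (simp add: power2_eq_square algebra_simps)
  moreover have "0 < \<theta> + c" "1 < \<theta>\<^sup>2" using assms one_less_power[of \<theta> 2] by auto
  ultimately show ?thesis
    unfolding Gamma0_minus_1[OF assms(1)] varpi_sq_def by (simp add: divide_simps)
qed

lemma mu_star_bounds:
  assumes \<theta>: "1 < \<theta>" and P: "pos_def P" "s \<noteq> 0" "b \<noteq> 0"
  shows "0 \<le> mu_star \<theta> P s b" and "mu_star \<theta> P s b \<le> sqrt (Gamma0 \<theta>) - 1"
proof -
  define g where "g = sqrt (Gamma0 \<theta>)"
  have g: "1 < g" "Gamma0 \<theta> = g\<^sup>2" using Gamma0_gt_1[OF \<theta>] by (simp_all add: g_def)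
  note c = abs_chi_le_1[OF P]
  show "0 \<le> mu_star \<theta> P s b"
    using varpi_sq_le[OF \<theta> c] g by (simp add: mu_star_def)
  have "g\<^sup>2 - 1 - varpi_sq \<theta> (chi_val P s b) \<le> (g - 1) * (g + 1)"
    using varpi_sq_nonneg[OF c] by (simp add: power2_eq_square algebra_simps)
  then show "mu_star \<theta> P s b \<le> sqrt (Gamma0 \<theta>) - 1"
    using g by (simp add: mu_star_def divide_le_eq)
qed

theorem mu_star_greatest:
  assumes \<theta>: "1 < \<theta>" and P: "pos_def P" "s \<noteq> 0" "b \<noteq> 0"
  defines "S \<equiv> {\<mu>. \<mu> \<ge> 0 \<and>
    transpose (M_matrix \<theta> P s b \<mu>) ** M_matrix \<theta> P s b \<mu> \<preceq>\<^sub>L Gamma0 \<theta> *\<^sub>R mat 1}"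
  shows "mu_star \<theta> P s b \<in> S" and "\<And>\<mu>. \<mu> \<in> S \<Longrightarrow> \<mu> \<le> mu_star \<theta> P s b"
proof -
  define u v c g a where "u = u_vec P s" and "v = v_vec P b" and "c = chi_val P s b"
    and "g = sqrt (Gamma0 \<theta>)" and "a = 1 / (\<theta> + c)"
  define \<mu>' where "\<mu>' = mu_star \<theta> P s b"
  note uv = normalised_vectors[OF P, folded u_def v_def c_def]
  have g: "1 < g" "Gamma0 \<theta> = g\<^sup>2" using Gamma0_gt_1[OF \<theta>] by (simp_all add: g_def)
  have M: "M_matrix \<theta> P s b \<mu> = rank_two_update a \<mu> u v" for \<mu>
    by (simp add: M_matrix_def rank_two_update_def Let_def u_def v_def c_def a_def)
  have var: "varpi_sq \<theta> c = a\<^sup>2 * (1 - (u \<bullet> v)\<^sup>2)"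
    by (simp add: varpi_sq_def a_def uv(3) power_divide)
  have eq: "(g + 1) * \<mu>' = g\<^sup>2 - 1 - a\<^sup>2 * (1 - (u \<bullet> v)\<^sup>2)"
    using g by (simp add: \<mu>'_def mu_star_def var[symmetric] c_def)
  have bounds: "0 \<le> \<mu>'" "\<mu>' \<le> g - 1"
    using mu_star_bounds[OF \<theta> P] by (simp_all add: \<mu>'_def g_def)
  show "mu_star \<theta> P s b \<in> S"
    using psd_rank_two_update[OF uv(1,2) bounds eq] g bounds
    by (simp add: S_def M \<mu>'_def[symmetric])
  show "\<mu> \<le> mu_star \<theta> P s b" if "\<mu> \<in> S" for \<mu>
  proof -
    have "0 \<le> (g + 1) * \<mu>'" using g bounds by simp
    then have "(g + 1) * \<mu> \<le> (g + 1) * \<mu>'"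
      using that g bounds eq
      by (intro rank_two_update_bound[OF uv(1,2) _ _ eq]) (auto simp: S_def M)
    then show ?thesis using g by (simp add: \<mu>'_def)
  qed
qed

theorem theorem5p2:
  fixes f :: "'m::finite \<Rightarrow> real^'n::finite \<Rightarrow> real"
    and L :: "'m \<Rightarrow> real"
    and \<tau> \<delta> \<theta> :: real
    and z b :: "nat \<Rightarrow> real^('n option)"
    and k :: nat
    and P :: "real^('n option)^('n option)"
    and s :: "real^('n option)"
  assumes f: "\<And>i. C1_lipschitz_grad (L i) (f i)"
    and \<tau>: "\<tau> > 0"
    and \<delta>: "\<delta> > 0"
    and \<theta>: "\<theta> > 1"
    and k: "k \<ge> 1"
    and P: "P = P_matrix f L \<delta> \<tau> (z k)"
    and s: "s = z k - z (k - 1)"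
    and s_nonzero: "s \<noteq> 0"
    and b_nonzero: "b k \<noteq> 0"
  shows "R_val \<theta> P s (b k) \<ge> 0
    \<and> (let S = {\<mu>. \<mu> \<ge> 0 \<and>
          transpose (M_matrix \<theta> P s (b k) \<mu>) ** M_matrix \<theta> P s (b k) \<mu> \<preceq>\<^sub>L Gamma0 \<theta> *\<^sub>R mat 1}
       in mu_star \<theta> P s (b k) \<in> S \<and> (\<forall>\<mu>\<in>S. \<mu> \<le> mu_star \<theta> P s (b k)))
    \<and> 0 \<le> mu_star \<theta> P s (b k) \<and> mu_star \<theta> P s (b k) \<le> sqrt (Gamma0 \<theta>) - 1
    \<and> (\<forall>\<tau>'>0. \<forall>z\<^sub>0 z\<^sub>1 b\<^sub>1. z\<^sub>1 - z\<^sub>0 \<noteq> 0 \<longrightarrow> b\<^sub>1 \<noteq> 0 \<longrightarrow>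
         mu_star \<theta> (P_matrix f L \<delta> \<tau>' z\<^sub>1) (z\<^sub>1 - z\<^sub>0) b\<^sub>1 \<le> sqrt (Gamma0 \<theta>) - 1)"
proof -
  have L: "0 \<le> L i" for i
    using f[of i] lipschitz_on_nonneg by (auto simp: C1_lipschitz_grad_def)
  have pd: "pos_def (P_matrix f L \<delta> \<tau>' w)" for \<tau>' w
    by (rule pos_def_P_matrix[OF L \<delta>])
  have pdP: "pos_def P" by (simp add: P pd)
  have "R_val \<theta> P s (b k) \<ge> 0"
    using varpi_sq_le[OF \<theta> abs_chi_le_1[OF pdP s_nonzero b_nonzero]] by (simp add: R_val_def)
  then show ?thesis
    unfolding Let_def
    using mu_star_greatest[OF \<theta> pdP s_nonzero b_nonzero]
      mu_star_bounds[OF \<theta> pdP s_nonzero b_nonzero] mu_star_bounds(2)[OF \<theta> pd]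
    by blast
qed

end
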